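(* For any $\boldsymbol x(0)\in\boldsymbol\Omega:=\prod_{i=1}^N\Omega_i$, the sequence $(\boldsymbol x(k))_{k\in\mathbb N}$ generated by $$\boldsymbol x(k+1)=\boldsymbol{\mathrm{prox}}_{\boldsymbol f}(\boldsymbol A\,\boldsymbol x(k)),\qquad k\in\mathbb N,$$ i.e. $x_i(k+1)=\mathrm{prox}_{\bar f_i}\big(\sum_{j=1}^N a_{i,j}x_j(k)\big)$ for all $i\in\mathcal N$, converges to a network equilibrium (NWE).
   Context: Let $\mathcal N=\{1,\dots,N\}$ and $n\ge1$. For each $i\in\mathcal N$, $\Omega_i\subset\mathbb{R}^n$ is nonempty, compact and convex, $\iota_{\Omega_i}$ is its indicator function ($0$ on $\Omega_i$, $+\infty$ elsewhere), and $\bar f_i:=f_i+\iota_{\Omega_i}:\mathbb{R}^n\to\mathbb{R}\cup\{\infty\}$ is proper, lower semicontinuous and convex. The cost of agent $i$ is $g_i(x_i,z):=\bar f_i(x_i)+\frac12\|x_i-z\|^2$. The matrix $A=[a_{i,j}]\in\mathbb{R}^{N\times N}$ is row stochastic ($a_{i,j}\ge0$, $\sum_j a_{i,j}=1$ for all $i$), has positive diagonal, $\underline a:=\min_i a_{i,i}>0$, and its associated digraph is strongly connected. $\boldsymbol A:=A\otimes I_n$. $\mathrm{prox}_{\bar f_i}(x):=\mathrm{argmin}_{y\in\mathbb{R}^n}\,\bar f_i(y)+\frac12\|x-y\|^2$, and $\boldsymbol{\mathrm{prox}}_{\boldsymbol f}(\mathrm{col}(z_1,\dots,z_N)):=\mathrm{col}(\mathrm{prox}_{\bar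 f_1}(z_1),\dots,\mathrm{prox}_{\bar f_N}(z_N))$. A vector $\bar{\boldsymbol x}=\mathrm{col}(\bar x_1,\dots,\bar x_N)\in\mathbb{R}^{nN}$ is a network equilibrium (NWE) if $\bar x_i=\mathrm{argmin}_{y\in\mathbb{R}^n}g_i\big(y,\sum_{j=1}^N a_{i,j}\bar x_j\big)$ for every $i\in\mathcal N$; equivalently, $\bar{\boldsymbol x}$ is a fixed point of $\boldsymbol{\mathrm{prox}}_{\boldsymbol f}\circ\boldsymbol A$. *)

theory Defs
  imports "HOL-Analysis.Analysis" "Graph_Theory.Digraph_Component"
begin

section \<open>Extended-real-valued convex functions\<close>

definition proper_fun :: "('a \<Rightarrow> ereal) \<Rightarrow> bool" where
  "proper_fun f \<longleftrightarrow> (\<forall>x. f x \<noteq> -\<infinity>) \<and> (\<exists>x. f x \<noteq> \<infinity>)"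

definition lsc_fun :: "('a::topological_space \<Rightarrow> ereal) \<Rightarrow> bool" where
  "lsc_fun f \<longleftrightarrow> (\<forall>x. f x \<le> Liminf (at x) f)"

text \<open>The endpoints \<open>u = 0\<close> and \<open>v = 0\<close> are harmless: \<open>0 * \<infinity> = 0\<close> for extended reals.\<close>

definition convex_fun :: "('a::real_vector \<Rightarrow> ereal) \<Rightarrow> bool" where
  "convex_fun f \<longleftrightarrow> (\<forall>x y. \<forall>u\<ge>0. \<forall>v\<ge>0. u + v = 1 \<longrightarrow>
     f (u *\<^sub>R x + v *\<^sub>R y) \<le> ereal u * f x + ereal v * f y)"

definition iota :: "'a set \<Rightarrow> 'a \<Rightarrow> ereal" where
  "iota S x = (if x \<in> S then 0 else \<infinity>)"

definition argmin_set :: "('a \<Rightarrow> ereal) \<Rightarrow> 'a set" where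
  "argmin_set h = {y. is_arg_min h (\<lambda>_. True) y}"

text \<open>
  The minimizer exists and is unique when \<open>h\<close> is proper, lower semicontinuous and convex;
  otherwise \<open>prox h x\<close> need not be meaningful.
\<close>

definition prox :: "('a::real_normed_vector \<Rightarrow> ereal) \<Rightarrow> 'a \<Rightarrow> 'a" where
  "prox h x = arg_min (\<lambda>y. h y + ereal (1/2 * (norm (x - y))\<^sup>2)) (\<lambda>_. True)"

section \<open>Communication matrix\<close>

definition row_stochastic :: "real ^ 'N ^ 'N \<Rightarrow> bool" where
  "row_stochastic A \<longleftrightarrow> (\<forall>i j. 0 \<le> A $ i $ j) \<and> (\<forall>i. (\<Sum>j\<in>UNIV. A $ i $ j) = 1)"

text \<open>
  An arc joins \<open>i\<close> to \<open>j\<close> if agent \<open>i\<close> uses the state of agent \<open>j\<close>; orienting arcs the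
  other way gives the same notion of strong connectivity.
\<close>

definition matrix_digraph :: "real ^ 'N ^ 'N \<Rightarrow> ('N, 'N \<times> 'N) pre_digraph" where
  "matrix_digraph A =
     \<lparr>verts = UNIV, arcs = {(i, j). A $ i $ j > 0}, tail = fst, head = snd\<rparr>"

section \<open>Proximal dynamics\<close>

text \<open>
  A stacked vector \<open>col(x\<^sub>1, \<dots>, x\<^sub>N)\<close> in \<open>\<real>\<^bsup>nN\<^esup>\<close> is an element of \<open>(real ^ 'n) ^ 'N\<close>, whose
  norm is the Euclidean one. Under this identification the Kronecker product of
  \<open>A\<close> with the \<open>n \<times> n\<close> identity acts blockwise.
\<close>

definition kron_id :: "real ^ 'N ^ 'N \<Rightarrow> (real ^ 'n) ^ 'N \<Rightarrow> (real ^ 'n) ^ 'N" where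
  "kron_id A x = (\<chi> i. \<Sum>j\<in>UNIV. (A $ i $ j) *\<^sub>R (x $ j))"

definition fbar :: "('N \<Rightarrow> 'a \<Rightarrow> ereal) \<Rightarrow> ('N \<Rightarrow> 'a set) \<Rightarrow> 'N \<Rightarrow> 'a \<Rightarrow> ereal" where
  "fbar f \<Omega> i x = f i x + iota (\<Omega> i) x"

definition stacked_prox ::
  "('N \<Rightarrow> real ^ 'n \<Rightarrow> ereal) \<Rightarrow> (real ^ 'n) ^ 'N \<Rightarrow> (real ^ 'n) ^ 'N" where
  "stacked_prox h z = (\<chi> i. prox (h i) (z $ i))"

definition cost ::
  "('N \<Rightarrow> real ^ 'n \<Rightarrow> ereal) \<Rightarrow> ('N \<Rightarrow> (real ^ 'n) set) \<Rightarrow> 'N \<Rightarrow> real ^ 'n \<Rightarrow> real ^ 'n \<Rightarrow> ereal"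
  where "cost f \<Omega> i y z = fbar f \<Omega> i y + ereal (1/2 * (norm (y - z))\<^sup>2)"

definition network_equilibrium ::
  "('N \<Rightarrow> real ^ 'n \<Rightarrow> ereal) \<Rightarrow> ('N \<Rightarrow> (real ^ 'n) set) \<Rightarrow> real ^ 'N ^ 'N
     \<Rightarrow> (real ^ 'n) ^ 'N \<Rightarrow> bool" where
  "network_equilibrium f \<Omega> A x \<longleftrightarrow>
     (\<forall>i. argmin_set (\<lambda>y. cost f \<Omega> i y (\<Sum>j\<in>UNIV. (A $ i $ j) *\<^sub>R (x $ j))) = {x $ i})"

end

theory Submission
  imports Defs
begin

text \<open>
  Write \<open>T = prox \<circ> A\<close>. Network equilibria are the fixed points of \<open>T\<close>, and at least one exists by
  Brouwer's theorem, because \<open>T\<close> is continuous and maps the compact convex product of the sets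
  \<open>\<Omega> i\<close> into itself. What has to be explained is why the iteration settles at one of them.

  A row stochastic matrix need not be nonexpansive in the Euclidean norm. It is nonexpansive in
  the norm \<open>(\<Sum>i. q\<^sub>i \<parallel>y\<^sub>i\<parallel>\<^sup>2)\<^sup>1\<^sup>/\<^sup>2\<close> weighted by a probability vector \<open>q\<close> with \<open>q A = q\<close>
  (\<open>positive_left_eigenvector\<close>); strong connectivity makes every \<open>q\<^sub>i\<close> positive, so this is a norm.
  The weights leave the proximal step undisturbed, since that step acts on each block separately.

  Nonexpansiveness alone would allow \<open>T\<close> to rotate around a fixed point. Both factors however lose
  weighted length by an explicit amount as soon as they change a difference vector:
  \<open>A\<close> by the variance within each row, which the positive diagonal entry bounds below by a multiple
  of \<open>\<parallel>y\<^sub>i - (A y)\<^sub>i\<parallel>\<^sup>2\<close> (\<open>weighted_sqnorm_kron_id\<close>), and the proximal map by firm nonexpansiveness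
  (\<open>weighted_sqnorm_stacked_prox\<close>). Hence, if the distance from \<open>T y\<close> to a fixed point \<open>z\<close> equals
  that from \<open>y\<close> to \<open>z\<close>, then \<open>T y - z = A (y - z) = y - z\<close> and \<open>y\<close> is itself fixed.
  On a compact set this strict form of Fejer monotonicity forces convergence of the whole
  orbit (\<open>strictly_Fejer_iteration_converges\<close>).
\<close>

section \<open>Minimizers of lower semicontinuous functions\<close>

lemma lsc_fun_iff_open_superlevel:
  "lsc_fun h \<longleftrightarrow> (\<forall>t. open {y. t < h y})"
proof
  assume lsc: "lsc_fun h"
  show "\<forall>t. open {y. t < h y}"
  proof
    fix t
    have "eventually (\<lambda>z. t < h z) (nhds y)" if "t < h y" for y
    proof -
      have "h y \<le> Liminf (at y) h"
        using lsc by (simp add: lsc_fun_def)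
      with that have "eventually (\<lambda>z. t < h z) (at y)"
        by (simp add: le_Liminf_iff)
      then show ?thesis
        using that by (auto simp: eventually_at_filter elim!: eventually_mono)
    qed
    then show "open {y. t < h y}"
      unfolding open_subopen[of "{y. t < h y}"] by (force simp: eventually_nhds)
  qed
next
  assume op: "\<forall>t. open {y. t < h y}"
  have "eventually (\<lambda>z. t < h z) (at y)" if "t < h y" for y t
    using op that unfolding eventually_at_topological by blast
  then show "lsc_fun h"
    by (simp add: lsc_fun_def le_Liminf_iff)
qed

lemma lsc_fun_add_continuous:
  assumes lsc: "lsc_fun h" and cont: "continuous_on UNIV g"
  shows "lsc_fun (\<lambda>y. h y + ereal (g y))"
  unfolding lsc_fun_iff_open_superlevel
proof
  fix t
  \<comment> \<open>The superlevel sets of the sum are unions of intersections of superlevel sets of the summands.\<close>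
  have "{y. t < h y + ereal (g y)} = (\<Union>r. {y. ereal r < h y} \<inter> {y. t < ereal r + ereal (g y)})"
  proof (intro set_eqI iffI)
    fix y assume "y \<in> {y. t < h y + ereal (g y)}"
    then have "t - ereal (g y) < h y"
      by (simp add: ereal_minus_less_iff)
    then obtain r where r: "t - ereal (g y) < ereal r" "ereal r < h y"
      using ereal_dense2 by blast
    from r(1) have "t < ereal r + ereal (g y)"
      by (cases t) auto
    with r show "y \<in> (\<Union>r. {y. ereal r < h y} \<inter> {y. t < ereal r + ereal (g y)})"
      by blast
  next
    fix y assume "y \<in> (\<Union>r. {y. ereal r < h y} \<inter> {y. t < ereal r + ereal (g y)})"
    then obtain r where "ereal r < h y" "t < ereal r + ereal (g y)"
      by blast
    then show "y \<in> {y. t < h y + ereal (g y)}"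
      by (metis add_right_mono less_imp_le mem_Collect_eq order_less_le_trans)
  qed
  moreover have "open {y. t < ereal r + ereal (g y)}" for r
    using cont by (intro open_Collect_less) (auto intro!: continuous_intros)
  ultimately show "open {y. t < h y + ereal (g y)}"
    using lsc by (simp add: lsc_fun_iff_open_superlevel open_UN open_Int)
qed

text \<open>If no point of \<open>S\<close> were minimal, the open sets \<open>{y. h z < h y}\<close> with \<open>z \<in> S\<close> would cover \<open>S\<close>;
  a finite subcover then fails to contain the best of its own finitely many centres \<open>z\<close>.\<close>

lemma lsc_fun_attains_min_on_compact:
  assumes lsc: "lsc_fun h" and S: "compact S" "S \<noteq> {}"
  shows "\<exists>p\<in>S. \<forall>y\<in>S. h p \<le> h y"
proof (rule ccontr)
  assume "\<not> ?thesis"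
  then have cover: "S \<subseteq> (\<Union>z\<in>S. {y. h z < h y})"
    by (force simp: not_le)
  obtain D where D: "D \<subseteq> S" "finite D" "S \<subseteq> (\<Union>z\<in>D. {y. h z < h y})"
    using compactE_image[OF S(1) _ cover] lsc by (metis lsc_fun_iff_open_superlevel)
  then have "D \<noteq> {}"
    using S(2) by auto
  then obtain z where z: "z \<in> D" "\<forall>w\<in>D. h z \<le> h w"
    using ex_min_if_finite[of "h ` D"] D(2) by (force simp: not_less)
  then obtain w where "w \<in> D" "h w < h z"
    using D by blast
  with z show False
    using not_le by blast
qed

section \<open>The proximal map\<close>

text \<open>The value of \<open>prox\<close> is an arbitrary choice among the minimizers. As a relation between the
  point and a minimizer, proximality makes sense before existence and uniqueness are known.\<close>

definition is_prox :: "('a::real_normed_vector \<Rightarrow> ereal) \<Rightarrow> 'a \<Rightarrow> 'a \<Rightarrow> bool" where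
  "is_prox h x p \<longleftrightarrow>
     is_arg_min (\<lambda>y. h y + ereal (1/2 * (norm (x - y))\<^sup>2)) (\<lambda>_. True) p"

lemma is_prox_iff:
  "is_prox h x p \<longleftrightarrow>
     (\<forall>y. h p + ereal (1/2 * (norm (x - p))\<^sup>2) \<le> h y + ereal (1/2 * (norm (x - y))\<^sup>2))"
  by (simp add: is_prox_def is_arg_min_linorder)

lemma is_prox_finite:
  assumes "is_prox h x p" "proper_fun h"
  shows "\<bar>h p\<bar> \<noteq> \<infinity>"
proof -
  obtain y where y: "h y \<noteq> \<infinity>" and "h p \<noteq> -\<infinity>"
    using assms by (auto simp: proper_fun_def)
  moreover have "h p + ereal (1/2 * (norm (x - p))\<^sup>2) \<le> h y + ereal (1/2 * (norm (x - y))\<^sup>2)"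
    using assms by (simp add: is_prox_iff)
  ultimately show ?thesis
    by (cases "h y"; cases "h p") auto
qed

text \<open>Moving from the minimizer \<open>p\<close> towards \<open>y\<close> by a fraction \<open>t\<close> changes the quadratic term by
  \<open>- t (x - p) \<bullet> (y - p)\<close> up to second order and \<open>h\<close> by at most \<open>t (h y - h p)\<close>; first-order
  optimality says that \<open>x - p\<close> is a subgradient of \<open>h\<close> at \<open>p\<close>.\<close>

lemma is_prox_subgradient:
  fixes h :: "'a::real_inner \<Rightarrow> ereal"
  assumes prox: "is_prox h x p" and proper: "proper_fun h" and conv: "convex_fun h"
  shows "h p + ereal ((x - p) \<bullet> (y - p)) \<le> h y"
proof (cases "h y = \<infinity>")
  case False
  obtain a where a: "h p = ereal a"
    using is_prox_finite[OF prox proper] by auto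
  obtain b where b: "h y = ereal b"
    using False proper by (cases "h y") (auto simp: proper_fun_def)
  have bound: "a + (x - p) \<bullet> (y - p) - b \<le> t / 2 * (norm (y - p))\<^sup>2" if t: "0 < t" "t \<le> 1" for t
  proof -
    define w where "w = (1 - t) *\<^sub>R p + t *\<^sub>R y"
    have xw: "x - w = (x - p) - t *\<^sub>R (y - p)"
      by (simp add: w_def algebra_simps)
    have "h w \<le> ereal (1 - t) * h p + ereal t * h y"
      using conv t by (simp add: convex_fun_def w_def)
    then have hw: "h w \<le> ereal ((1 - t) * a + t * b)"
      by (simp add: a b)
    have "ereal a + ereal (1/2 * (norm (x - p))\<^sup>2) \<le> h w + ereal (1/2 * (norm (x - w))\<^sup>2)"
      using prox by (simp add: is_prox_iff flip: a)
    also have "\<dots> \<le> ereal ((1 - t) * a + t * b) + ereal (1/2 * (norm (x - w))\<^sup>2)"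
      using hw by (rule add_right_mono)
    finally have "a + 1/2 * (norm (x - p))\<^sup>2 \<le> (1 - t) * a + t * b + 1/2 * (norm (x - w))\<^sup>2"
      by simp
    moreover have "(norm (x - w))\<^sup>2 =
        (norm (x - p))\<^sup>2 - 2 * t * ((x - p) \<bullet> (y - p)) + t\<^sup>2 * (norm (y - p))\<^sup>2"
      unfolding xw power2_norm_eq_inner
      by (simp add: inner_diff_left inner_diff_right inner_commute power2_eq_square algebra_simps)
    ultimately have "t * (a + (x - p) \<bullet> (y - p) - b) \<le> t * (t / 2 * (norm (y - p))\<^sup>2)"
      by (simp add: algebra_simps power2_eq_square)
    then show ?thesis
      using t(1) mult_le_cancel_left_pos by blast
  qed
  have "((\<lambda>t. t / 2 * (norm (y - p))\<^sup>2) \<longlongrightarrow> 0 / 2 * (norm (y - p))\<^sup>2) (at_right 0)"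
    by (intro tendsto_intros) auto
  moreover have "eventually (\<lambda>t. a + (x - p) \<bullet> (y - p) - b \<le> t / 2 * (norm (y - p))\<^sup>2) (at_right 0)"
    unfolding eventually_at_right_field using bound by (intro exI[of _ 1]) auto
  ultimately have "a + (x - p) \<bullet> (y - p) - b \<le> 0 / 2 * (norm (y - p))\<^sup>2"
    by (rule tendsto_lowerbound) simp
  then show ?thesis
    by (simp add: a b)
qed simp

text \<open>The subgradients of a convex function form a monotone relation, and monotonicity of
  \<open>x - p\<close> in \<open>p\<close> is exactly firm nonexpansiveness of \<open>x \<mapsto> p\<close>.\<close>

lemma is_prox_firmly_nonexpansive:
  fixes h :: "'a::real_inner \<Rightarrow> ereal"
  assumes p: "is_prox h x p" and p': "is_prox h x' p'"
    and h: "proper_fun h" "convex_fun h"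
  shows "(norm (p - p'))\<^sup>2 + (norm ((x - x') - (p - p')))\<^sup>2 \<le> (norm (x - x'))\<^sup>2"
proof -
  obtain a where a: "h p = ereal a"
    using is_prox_finite[OF p h(1)] by auto
  obtain b where b: "h p' = ereal b"
    using is_prox_finite[OF p' h(1)] by auto
  have "a + (x - p) \<bullet> (p' - p) \<le> b" "b + (x' - p') \<bullet> (p - p') \<le> a"
    using is_prox_subgradient[OF p h, of p'] is_prox_subgradient[OF p' h, of p] by (simp_all add: a b)
  then have "(x - p) \<bullet> (p' - p) + (x' - p') \<bullet> (p - p') \<le> 0"
    by simp
  then show ?thesis
    unfolding power2_norm_eq_inner
    by (simp add: inner_diff_left inner_diff_right inner_commute algebra_simps)
qed

lemma is_prox_unique:
  fixes h :: "'a::real_inner \<Rightarrow> ereal"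
  assumes "is_prox h x p" "is_prox h x p'" "proper_fun h" "convex_fun h"
  shows "p = p'"
  using is_prox_firmly_nonexpansive[OF assms] by (simp add: norm_minus_commute[of p' p])

lemma is_prox_prox:
  fixes h :: "'a::real_normed_vector \<Rightarrow> ereal"
  assumes h: "lsc_fun h" and S: "compact S" "S \<noteq> {}" and dom: "\<And>y. y \<notin> S \<Longrightarrow> h y = \<infinity>"
  shows "is_prox h x (prox h x)"
proof -
  have "lsc_fun (\<lambda>y. h y + ereal (1/2 * (norm (x - y))\<^sup>2))"
    using h by (rule lsc_fun_add_continuous) (intro continuous_intros)
  then obtain p where p: "\<And>y. y \<in> S \<Longrightarrow>
      h p + ereal (1/2 * (norm (x - p))\<^sup>2) \<le> h y + ereal (1/2 * (norm (x - y))\<^sup>2)"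
    using lsc_fun_attains_min_on_compact[OF _ S] by meson
  then have "is_prox h x p"
    unfolding is_prox_iff by (metis dom ereal_less_eq(1) plus_ereal.simps(2))
  then show ?thesis
    unfolding prox_def is_prox_def arg_min_def by (rule someI)
qed

section \<open>Stochastic matrices in a weighted Euclidean norm\<close>

text \<open>A row stochastic matrix acts on probability vectors from the right, so Brouwer's theorem on
  the simplex supplies an invariant one. Its support is closed under following arcs, hence is
  everything when the digraph is strongly connected.\<close>

lemma positive_left_eigenvector:
  fixes A :: "real ^ 'N ^ 'N::finite"
  assumes A: "row_stochastic A" and sc: "strongly_connected (matrix_digraph A)"
  obtains q :: "'N \<Rightarrow> real"
  where "\<And>i. 0 < q i" "\<And>j. (\<Sum>i\<in>UNIV. q i * A $ i $ j) = q j"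
proof -
  have A0: "0 \<le> A $ i $ j" and A1: "(\<Sum>j\<in>UNIV. A $ i $ j) = 1" for i j
    using A by (auto simp: row_stochastic_def)
  define P :: "(real ^ 'N) set" where "P = {q. (\<forall>i. 0 \<le> q $ i) \<and> (\<Sum>i\<in>UNIV. q $ i) = 1}"
  define F :: "real ^ 'N \<Rightarrow> real ^ 'N" where "F q = (\<chi> j. \<Sum>i\<in>UNIV. q $ i * A $ i $ j)" for q
  have "bounded P"
    unfolding bounded_iff
  proof (intro exI ballI)
    fix q assume q: "q \<in> P"
    have "norm q \<le> (\<Sum>i\<in>UNIV. \<bar>q $ i\<bar>)"
      by (rule norm_le_l1_cart)
    also have "\<dots> = 1"
      using q by (simp add: P_def)
    finally show "norm q \<le> 1" .
  qed
  moreover have "closed P"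
    unfolding P_def
    by (intro closed_Collect_conj closed_Collect_all closed_Collect_le closed_Collect_eq continuous_intros)
  ultimately have "compact P"
    by (simp add: compact_eq_bounded_closed)
  moreover have "convex P"
    by (auto simp: P_def convex_def sum.distrib simp flip: sum_distrib_left)
  moreover have "P \<noteq> {}"
  proof -
    have "axis undefined 1 \<in> P"
      by (simp add: P_def axis_def sum.delta)
    then show ?thesis by blast
  qed
  moreover have "continuous_on P F"
    unfolding F_def by (intro continuous_intros)
  moreover have "F \<in> P \<rightarrow> P"
  proof
    fix q assume q: "q \<in> P"
    have "(\<Sum>j\<in>UNIV. \<Sum>i\<in>UNIV. q $ i * A $ i $ j) = (\<Sum>i\<in>UNIV. q $ i * (\<Sum>j\<in>UNIV. A $ i $ j))"
      by (subst sum.swap) (simp add: sum_distrib_left)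
    also have "\<dots> = 1"
      using q by (simp add: A1 P_def)
    finally show "F q \<in> P"
      using q A0 by (simp add: F_def P_def sum_nonneg)
  qed
  ultimately obtain q where q: "q \<in> P" "F q = q"
    by (rule brouwer)
  then have q0: "0 \<le> q $ i" and q1: "(\<Sum>i\<in>UNIV. q $ i) = 1"
    and inv: "(\<Sum>i\<in>UNIV. q $ i * A $ i $ j) = q $ j" for i j
    by (auto simp: P_def F_def vec_eq_iff)
  have q_step: "0 < q $ v" if "0 < q $ u" "0 < A $ u $ v" for u v
  proof -
    have "0 < q $ u * A $ u $ v"
      using that by simp
    also have "\<dots> \<le> (\<Sum>i\<in>UNIV. q $ i * A $ i $ v)"
      by (rule member_le_sum) (simp_all add: q0 A0)
    finally show ?thesis
      by (simp add: inv)
  qed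
  obtain u where u: "0 < q $ u"
    using q0 q1 by (metis less_eq_real_def sum.neutral zero_neq_one)
  have "0 < q $ v" for v
  proof -
    have "(u, v) \<in> (arcs_ends (matrix_digraph A))\<^sup>*"
      using sc by (intro reachable_rtranclI) (simp add: strongly_connected_def matrix_digraph_def)
    then show ?thesis
    proof (induction rule: rtrancl_induct)
      case (step y z)
      then show ?case
        using q_step by (auto simp: arcs_ends_conv matrix_digraph_def)
    qed (rule u)
  qed
  then show thesis
    using that[of "\<lambda>i. q $ i"] inv by blast
qed

lemma norm_weighted_mean:
  fixes y :: "'i::finite \<Rightarrow> 'a::real_inner"
  assumes "(\<Sum>j\<in>UNIV. a j) = 1"
  defines "m \<equiv> \<Sum>j\<in>UNIV. a j *\<^sub>R y j"
  shows "(norm m)\<^sup>2 + (\<Sum>j\<in>UNIV. a j * (norm (y j - m))\<^sup>2) = (\<Sum>j\<in>UNIV. a j * (norm (y j))\<^sup>2)"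
proof -
  have "(\<Sum>j\<in>UNIV. a j * (norm (y j - m))\<^sup>2)
      = (\<Sum>j\<in>UNIV. a j * (norm (y j))\<^sup>2 - 2 * ((a j *\<^sub>R y j) \<bullet> m) + a j * (norm m)\<^sup>2)"
    unfolding power2_norm_eq_inner
    by (intro sum.cong) (auto simp: inner_diff_left inner_diff_right inner_commute algebra_simps)
  also have "\<dots> = (\<Sum>j\<in>UNIV. a j * (norm (y j))\<^sup>2) - 2 * (m \<bullet> m) + (norm m)\<^sup>2"
    by (simp add: sum.distrib sum_subtractf assms(1) m_def inner_sum_left
        flip: sum_distrib_left sum_distrib_right)
  finally show ?thesis
    by (simp add: power2_norm_eq_inner)
qed

definition weighted_sqnorm :: "('N::finite \<Rightarrow> real) \<Rightarrow> 'a::real_normed_vector ^ 'N \<Rightarrow> real" where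
  "weighted_sqnorm q y = (\<Sum>i\<in>UNIV. q i * (norm (y $ i))\<^sup>2)"

lemma weighted_sqnorm_nonneg: "(\<And>i. 0 \<le> q i) \<Longrightarrow> 0 \<le> weighted_sqnorm q y"
  by (simp add: weighted_sqnorm_def sum_nonneg)

lemma weighted_sqnorm_eq_0_iff:
  "(\<And>i. 0 < q i) \<Longrightarrow> weighted_sqnorm q y = 0 \<longleftrightarrow> y = 0"
  unfolding weighted_sqnorm_def
  by (subst sum_nonneg_eq_0_iff) (auto simp: vec_eq_iff less_imp_le, metis less_irrefl)

lemma weighted_sqnorm_lower_bound:
  fixes q :: "'N::finite \<Rightarrow> real"
  assumes "\<And>i. 0 < q i"
  shows "\<exists>m>0. \<forall>y :: 'a::real_normed_vector ^ 'N. m * (norm y)\<^sup>2 \<le> weighted_sqnorm q y"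
proof (intro exI conjI allI)
  show "0 < Min (range q)"
    using assms by simp
  fix y :: "'a ^ 'N"
  have "(norm y)\<^sup>2 = (\<Sum>i\<in>UNIV. (norm (y $ i))\<^sup>2)"
    by (simp add: norm_vec_def L2_set_def sum_nonneg)
  then show "Min (range q) * (norm y)\<^sup>2 \<le> weighted_sqnorm q y"
    by (simp add: weighted_sqnorm_def sum_distrib_left sum_mono mult_right_mono)
qed

text \<open>In each row the squared norm of a mean falls short of the mean of the squared norms by the
  variance, of which only the contribution of the diagonal entry is kept. Summing the rows with
  the invariant weights turns the mean of squared norms back into the weighted norm of \<open>y\<close>.\<close>

lemma weighted_sqnorm_kron_id:
  fixes A :: "real ^ 'N ^ 'N::finite" and y :: "(real ^ 'n::finite) ^ 'N"
  assumes A: "row_stochastic A" and q: "\<And>i. 0 < q i"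
    and inv: "\<And>j. (\<Sum>i\<in>UNIV. q i * A $ i $ j) = q j"
  shows "weighted_sqnorm q (kron_id A y)
      + weighted_sqnorm (\<lambda>i. q i * A $ i $ i) (y - kron_id A y) \<le> weighted_sqnorm q y"
proof -
  have A0: "0 \<le> A $ i $ j" and A1: "(\<Sum>j\<in>UNIV. A $ i $ j) = 1" for i j
    using A by (auto simp: row_stochastic_def)
  have row: "(norm (kron_id A y $ i))\<^sup>2 + A $ i $ i * (norm (y $ i - kron_id A y $ i))\<^sup>2
      \<le> (\<Sum>j\<in>UNIV. A $ i $ j * (norm (y $ j))\<^sup>2)" for i
  proof -
    have "A $ i $ i * (norm (y $ i - kron_id A y $ i))\<^sup>2
        \<le> (\<Sum>j\<in>UNIV. A $ i $ j * (norm (y $ j - kron_id A y $ i))\<^sup>2)"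
      by (rule member_le_sum[where f = "\<lambda>j. A $ i $ j * (norm (y $ j - kron_id A y $ i))\<^sup>2"])
        (simp_all add: A0)
    then show ?thesis
      using norm_weighted_mean[OF A1[of i], of "\<lambda>j. y $ j"] by (simp add: kron_id_def)
  qed
  have "weighted_sqnorm q (kron_id A y) + weighted_sqnorm (\<lambda>i. q i * A $ i $ i) (y - kron_id A y)
      = (\<Sum>i\<in>UNIV. q i * ((norm (kron_id A y $ i))\<^sup>2
          + A $ i $ i * (norm (y $ i - kron_id A y $ i))\<^sup>2))"
    by (simp add: weighted_sqnorm_def algebra_simps flip: sum.distrib)
  also have "\<dots> \<le> (\<Sum>i\<in>UNIV. q i * (\<Sum>j\<in>UNIV. A $ i $ j * (norm (y $ j))\<^sup>2))"
    using row q by (intro sum_mono mult_left_mono) (auto intro: less_imp_le)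
  also have "\<dots> = (\<Sum>j\<in>UNIV. (\<Sum>i\<in>UNIV. q i * A $ i $ j) * (norm (y $ j))\<^sup>2)"
    unfolding sum_distrib_left sum_distrib_right by (subst sum.swap) (simp add: mult.assoc)
  also have "\<dots> = weighted_sqnorm q y"
    by (simp add: inv weighted_sqnorm_def)
  finally show ?thesis .
qed

section \<open>Fejer monotone iterations\<close>

text \<open>Along the orbit the merit \<open>\<lambda>y. V y p\<close> decreases to a limit, so it takes the same value at a
  cluster point \<open>c\<close> and at \<open>T c\<close>; this forces \<open>T c = c\<close>. Measured from \<open>c\<close> itself, the decreasing
  merit tends to \<open>0\<close> along a subsequence and therefore along the whole orbit.\<close>

lemma strictly_Fejer_iteration_converges:
  fixes T :: "'a::metric_space \<Rightarrow> 'a" and V :: "'a \<Rightarrow> 'a \<Rightarrow> real"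
  assumes S: "compact S" and T: "continuous_on S T" "T \<in> S \<rightarrow> S"
    and x0: "x 0 \<in> S" and xSuc: "\<And>k. x (Suc k) = T (x k)"
    and p: "p \<in> S" "T p = p"
    and V: "\<And>z. continuous_on S (\<lambda>y. V y z)" "\<And>z. V z z = 0"
    and m: "0 < m" "\<And>y z. m * (dist y z)\<^sup>2 \<le> V y z"
    and dec: "\<And>y z. \<lbrakk>y \<in> S; z \<in> S; T z = z\<rbrakk> \<Longrightarrow> V (T y) z \<le> V y z"
    and strict: "\<And>y z. \<lbrakk>y \<in> S; z \<in> S; T z = z; V (T y) z = V y z\<rbrakk> \<Longrightarrow> T y = y"
  shows "\<exists>c\<in>S. T c = c \<and> x \<longlonglongrightarrow> c"
proof -
  have xS: "x k \<in> S" for k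
    by (induction k) (use x0 xSuc T(2) in auto)
  have conv: "convergent (\<lambda>k. V (x k) z)" if "z \<in> S" "T z = z" for z
  proof -
    have "decseq (\<lambda>k. V (x k) z)"
      using dec[OF xS that] by (simp add: decseq_Suc_iff xSuc)
    moreover have "0 \<le> V (x k) z" for k
      using m(2)[of "x k" z] m(1) by (metis mult_nonneg_nonneg less_imp_le order_trans zero_le_power2)
    ultimately show ?thesis
      by (metis decseq_convergent convergentI)
  qed
  obtain c r where c: "c \<in> S" "strict_mono r" "(\<lambda>k. x (r k)) \<longlonglongrightarrow> c"
    using S xS unfolding compact_def o_def by metis
  have V_sub: "(\<lambda>k. V (x (r k)) z) \<longlonglongrightarrow> V c z" for z
    using continuous_on_tendsto_compose[OF V(1) c(3,1)] xS by simp
  have "(\<lambda>k. T (x (r k))) \<longlonglongrightarrow> T c"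
    using continuous_on_tendsto_compose[OF T(1) c(3,1)] xS by simp
  then have VT_sub: "(\<lambda>k. V (x (Suc (r k))) p) \<longlonglongrightarrow> V (T c) p"
    unfolding xSuc
    using T(2) c(1) xS by (intro continuous_on_tendsto_compose[OF V(1)]) (auto simp: Pi_iff)
  obtain L where L: "(\<lambda>k. V (x k) p) \<longlonglongrightarrow> L"
    using conv[OF p] by (auto simp: convergent_def)
  have "(\<lambda>k. V (x (r k)) p) \<longlonglongrightarrow> L"
    using LIMSEQ_subseq_LIMSEQ[OF L c(2)] by (simp add: o_def)
  moreover have "(\<lambda>k. V (x (Suc (r k))) p) \<longlonglongrightarrow> L"
    using LIMSEQ_subseq_LIMSEQ[OF LIMSEQ_Suc[OF L] c(2)] by (simp add: o_def)
  ultimately have "V (T c) p = V c p"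
    using V_sub VT_sub by (metis LIMSEQ_unique)
  then have Tc: "T c = c"
    by (rule strict[OF c(1) p])
  obtain L' where L': "(\<lambda>k. V (x k) c) \<longlonglongrightarrow> L'"
    using conv[OF c(1) Tc] by (auto simp: convergent_def)
  have "(\<lambda>k. V (x (r k)) c) \<longlonglongrightarrow> L'"
    using LIMSEQ_subseq_LIMSEQ[OF L' c(2)] by (simp add: o_def)
  then have "L' = 0"
    using V_sub[of c] by (simp add: V(2) LIMSEQ_unique)
  then have lim: "(\<lambda>k. V (x k) c / m) \<longlonglongrightarrow> 0"
    using tendsto_divide[OF L' tendsto_const[of m]] m(1) by simp
  have "(\<lambda>k. (dist (x k) c)\<^sup>2) \<longlonglongrightarrow> 0"
    by (rule tendsto_sandwich[OF _ _ tendsto_const lim])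
      (use m in \<open>simp_all add: pos_le_divide_eq mult.commute\<close>)
  then have "(\<lambda>k. dist (x k) c) \<longlonglongrightarrow> 0"
    using tendsto_real_sqrt[of "\<lambda>k. (dist (x k) c)\<^sup>2" 0] by simp
  then show ?thesis
    using c(1) Tc tendsto_dist_iff by blast
qed

section \<open>Convergence of the proximal dynamics\<close>

lemma compact_vec_box:
  fixes \<Omega> :: "'N::finite \<Rightarrow> 'a::euclidean_space set"
  assumes "\<And>i. compact (\<Omega> i)"
  shows "compact {y :: 'a ^ 'N. \<forall>i. y $ i \<in> \<Omega> i}"
proof -
  have "closed {y :: 'a ^ 'N. y $ i \<in> \<Omega> i}" for i
    using continuous_closed_vimage[of "\<Omega> i" "\<lambda>y :: 'a ^ 'N. y $ i"] assms
    by (auto simp: vimage_def compact_imp_closed)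
  then have "closed {y :: 'a ^ 'N. \<forall>i. y $ i \<in> \<Omega> i}"
    by (intro closed_Collect_all)
  moreover obtain B where B: "\<And>i y. y \<in> \<Omega> i \<Longrightarrow> norm y \<le> B i"
  proof -
    have "\<forall>i. \<exists>b. \<forall>y\<in>\<Omega> i. norm y \<le> b"
      using assms compact_imp_bounded bounded_iff by blast
    then show thesis
      using that by metis
  qed
  have "norm y \<le> (\<Sum>i\<in>UNIV. B i)" if "\<forall>i. y $ i \<in> \<Omega> i" for y :: "'a ^ 'N"
  proof -
    have "norm y \<le> (\<Sum>i\<in>UNIV. norm (y $ i))"
      unfolding norm_vec_def by (rule L2_set_le_sum) simp
    also have "\<dots> \<le> (\<Sum>i\<in>UNIV. B i)"
      using B that by (intro sum_mono) blast
    finally show ?thesis .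
  qed
  then have "bounded {y :: 'a ^ 'N. \<forall>i. y $ i \<in> \<Omega> i}"
    unfolding bounded_iff by blast
  ultimately show ?thesis
    by (simp add: compact_eq_bounded_closed)
qed

lemma network_equilibrium_iff_fixed_point:
  assumes h: "\<And>i. proper_fun (fbar f \<Omega> i)" "\<And>i. convex_fun (fbar f \<Omega> i)"
    and prox: "\<And>i z. is_prox (fbar f \<Omega> i) z (prox (fbar f \<Omega> i) z)"
  shows "network_equilibrium f \<Omega> A x \<longleftrightarrow> stacked_prox (fbar f \<Omega>) (kron_id A x) = x"
proof -
  have "argmin_set (\<lambda>y. cost f \<Omega> i y z) = {prox (fbar f \<Omega> i) z}" for i z
  proof -
    have "argmin_set (\<lambda>y. cost f \<Omega> i y z) = {p. is_prox (fbar f \<Omega> i) z p}"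
      by (simp add: argmin_set_def cost_def is_prox_def norm_minus_commute)
    also have "\<dots> = {prox (fbar f \<Omega> i) z}"
      using prox is_prox_unique[OF _ _ h] by blast
    finally show ?thesis .
  qed
  then show ?thesis
    by (simp add: network_equilibrium_def stacked_prox_def kron_id_def vec_eq_iff)
qed

lemma weighted_sqnorm_stacked_prox:
  fixes z z' :: "(real ^ 'n::finite) ^ 'N::finite"
  assumes h: "\<And>i. proper_fun (h i)" "\<And>i. convex_fun (h i)"
    and prox: "\<And>i z. is_prox (h i) z (prox (h i) z)" and q: "\<And>i. 0 \<le> q i"
  shows "weighted_sqnorm q (stacked_prox h z - stacked_prox h z')
      + weighted_sqnorm q ((z - z') - (stacked_prox h z - stacked_prox h z'))
      \<le> weighted_sqnorm q (z - z')"
  unfolding weighted_sqnorm_def sum.distrib[symmetric] distrib_left[symmetric]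
  using is_prox_firmly_nonexpansive[OF prox prox h] q
  by (intro sum_mono mult_left_mono) (simp_all add: stacked_prox_def)

lemma kron_id_diff: "kron_id A (x - y) = kron_id A x - kron_id A y"
  by (simp add: kron_id_def vec_eq_iff scaleR_diff_right sum_subtractf)

theorem theorem1:
  fixes \<Omega> :: "'N::finite \<Rightarrow> (real ^ 'n::finite) set"
    and f :: "'N \<Rightarrow> real ^ 'n \<Rightarrow> ereal"
    and A :: "real ^ 'N ^ 'N"
    and x :: "nat \<Rightarrow> (real ^ 'n) ^ 'N"
  assumes "\<And>i. \<Omega> i \<noteq> {}" and "\<And>i. compact (\<Omega> i)" and "\<And>i. convex (\<Omega> i)"
    and "\<And>i y. f i y \<noteq> -\<infinity>"
    and "\<And>i. proper_fun (fbar f \<Omega> i)"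
    and "\<And>i. lsc_fun (fbar f \<Omega> i)"
    and "\<And>i. convex_fun (fbar f \<Omega> i)"
    and "row_stochastic A"
    and "\<And>i. A $ i $ i > 0"
    and "strongly_connected (matrix_digraph A)"
    and "\<And>i. x 0 $ i \<in> \<Omega> i"
    and "\<And>k. x (Suc k) = stacked_prox (fbar f \<Omega>) (kron_id A (x k))"
  shows "\<exists>xbar. network_equilibrium f \<Omega> A xbar \<and> x \<longlonglongrightarrow> xbar"
proof -
  note h = assms(5,7)
  have dom: "fbar f \<Omega> i y = \<infinity>" if "y \<notin> \<Omega> i" for i y
    using that assms(4) by (simp add: fbar_def iota_def)
  have prox: "is_prox (fbar f \<Omega> i) z (prox (fbar f \<Omega> i) z)" for i z
    using is_prox_prox[OF assms(6,2,1)] dom by blast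
  define T where "T y = stacked_prox (fbar f \<Omega>) (kron_id A y)" for y
  define S where "S = {y. \<forall>i. y $ i \<in> \<Omega> i}"
  obtain q where q: "\<And>i. 0 < q i" and inv: "\<And>j. (\<Sum>i\<in>UNIV. q i * A $ i $ j) = q j"
    using positive_left_eigenvector[OF assms(8,10)] by blast
  have q0: "0 \<le> q i" for i
    using q less_imp_le by blast
  obtain m where m: "0 < m"
    "\<And>y :: (real ^ 'n) ^ 'N. m * (norm y)\<^sup>2 \<le> weighted_sqnorm q y"
    using weighted_sqnorm_lower_bound[of q] q by blast
  have V_cont: "continuous_on U (\<lambda>y. weighted_sqnorm q (y - z))" for U and z :: "(real ^ 'n) ^ 'N"
    unfolding weighted_sqnorm_def by (intro continuous_intros)
  have decrease: "weighted_sqnorm q (T y - T z)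
      + weighted_sqnorm q (kron_id A (y - z) - (T y - T z))
      + weighted_sqnorm (\<lambda>i. q i * A $ i $ i) ((y - z) - kron_id A (y - z))
      \<le> weighted_sqnorm q (y - z)" for y z
    using weighted_sqnorm_stacked_prox[of "fbar f \<Omega>" q "kron_id A y" "kron_id A z", OF h prox q0]
      weighted_sqnorm_kron_id[OF assms(8) q inv, of "y - z"]
    by (simp add: T_def kron_id_diff)
  have loss_nonneg: "0 \<le> weighted_sqnorm q y"
    "0 \<le> weighted_sqnorm (\<lambda>i. q i * A $ i $ i) y" for y :: "(real ^ 'n) ^ 'N"
    using q0 assms(9) by (auto intro!: weighted_sqnorm_nonneg simp: less_imp_le)
  have nonexp: "weighted_sqnorm q (T y - T z) \<le> weighted_sqnorm q (y - z)" for y z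
    using decrease[of y z] loss_nonneg by (smt (verit))
  \<comment> \<open>If nothing is lost, the averaging and the proximal step both leave \<open>y - z\<close> unchanged.\<close>
  have rigid: "T y - T z = y - z"
    if "weighted_sqnorm q (T y - T z) = weighted_sqnorm q (y - z)" for y z
  proof -
    have "weighted_sqnorm q (kron_id A (y - z) - (T y - T z)) = 0"
      "weighted_sqnorm (\<lambda>i. q i * A $ i $ i) ((y - z) - kron_id A (y - z)) = 0"
      using decrease[of y z] loss_nonneg that by (smt (verit))+
    then show ?thesis
      using q assms(9) by (simp add: weighted_sqnorm_eq_0_iff)
  qed
  have T_cont: "continuous_on S T"
    unfolding continuous_on_def
  proof
    fix z assume "z \<in> S"
    have "((\<lambda>y. weighted_sqnorm q (y - z) / m) \<longlongrightarrow> weighted_sqnorm q (z - z) / m) (at z within S)"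
      using V_cont[of S z] \<open>z \<in> S\<close> m(1) by (intro tendsto_intros) (auto simp: continuous_on_def)
    then have lim: "((\<lambda>y. weighted_sqnorm q (y - z) / m) \<longlongrightarrow> 0) (at z within S)"
      by (simp add: weighted_sqnorm_def)
    have "m * (norm (T y - T z))\<^sup>2 \<le> weighted_sqnorm q (y - z)" for y
      using m(2) nonexp order_trans by blast
    then have "((\<lambda>y. (norm (T y - T z))\<^sup>2) \<longlongrightarrow> 0) (at z within S)"
      by (intro tendsto_sandwich[OF _ _ tendsto_const lim])
        (use m(1) in \<open>simp_all add: pos_le_divide_eq mult.commute\<close>)
    then have "((\<lambda>y. norm (T y - T z)) \<longlongrightarrow> 0) (at z within S)"
      using tendsto_real_sqrt[of "\<lambda>y. (norm (T y - T z))\<^sup>2" 0] by simp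
    then show "(T \<longlongrightarrow> T z) (at z within S)"
      by (subst tendsto_dist_iff) (simp add: dist_norm)
  qed
  have "prox (fbar f \<Omega> i) z \<in> \<Omega> i" for i z
    using is_prox_finite[OF prox h(1)] dom by (metis abs_ereal.simps(3))
  then have T_S: "T \<in> S \<rightarrow> S"
    by (simp add: T_def S_def stacked_prox_def)
  have "compact S"
    unfolding S_def by (rule compact_vec_box[OF assms(2)])
  moreover have "convex S"
    using assms(3) by (auto simp: S_def convex_def)
  moreover have "S \<noteq> {}"
    using assms(11) by (auto simp: S_def)
  ultimately obtain p where p: "p \<in> S" "T p = p"
    using brouwer[OF _ _ _ T_cont T_S] by blast
  have "x 0 \<in> S" and "\<And>k. x (Suc k) = T (x k)"
    using assms(11,12) by (simp_all add: S_def T_def)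
  then have "\<exists>c\<in>S. T c = c \<and> x \<longlonglongrightarrow> c"
  proof (rule strictly_Fejer_iteration_converges[OF \<open>compact S\<close> T_cont T_S,
        where V = "\<lambda>y z. weighted_sqnorm q (y - z)"])
    show "T p = p" "p \<in> S"
      using p by simp_all
    show "m * (dist y z)\<^sup>2 \<le> weighted_sqnorm q (y - z)" for y z :: "(real ^ 'n) ^ 'N"
      using m(2) by (simp add: dist_norm)
    show "weighted_sqnorm q (z - z) = 0" for z :: "(real ^ 'n) ^ 'N"
      by (simp add: weighted_sqnorm_def)
    show "T y = y" if "T z = z" "weighted_sqnorm q (T y - z) = weighted_sqnorm q (y - z)" for y z
      using rigid[of y z] that by simp
    show "weighted_sqnorm q (T y - z) \<le> weighted_sqnorm q (y - z)" if "T z = z" for y z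
      using nonexp[of y z] that by simp
  qed (rule V_cont m(1))+
  then show ?thesis
    using network_equilibrium_iff_fixed_point[OF h prox] by (auto simp: T_def)
qed

end
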